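(* Let $q$ and $t$ be odd primes such that $q=2t+1$. Then $\mathcal{S}_q=\mathcal{O}_q=\langle 4\rangle$.
   Context: $\mathbb{F}_q$ is the finite field with $q$ elements and $\mathbb{F}_q^*$ its multiplicative group. $\mathcal{S}_q=\{a^2 : a\in\mathbb{F}_q^*\}$ is the set of nonzero squares, and $\mathcal{O}_q=\{a\in\mathbb{F}_q^* : \text{the multiplicative order of } a \text{ is odd}\}$. $\langle a\rangle$ denotes the cyclic subgroup of $\mathbb{F}_q^*$ generated by $a$; integers are read as elements of $\mathbb{F}_q$. *)

theory Defs
  imports "HOL-Computational_Algebra.Primes" "HOL-Algebra.Multiplicative_Group"
    "HOL-Algebra.Generated_Groups"
begin

definition nonzero_squares :: "('a, 'b) ring_scheme \<Rightarrow> 'a set" where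
  "nonzero_squares F = {a [^]\<^bsub>F\<^esub> (2::nat) | a. a \<in> carrier (mult_of F)}"

definition odd_order_elements :: "('a, 'b) ring_scheme \<Rightarrow> 'a set" where
  "odd_order_elements F = {a \<in> carrier (mult_of F). odd (group.ord (mult_of F) a)}"

definition cyclic_mult_subgroup :: "('a, 'b) ring_scheme \<Rightarrow> 'a \<Rightarrow> 'a set" where
  "cyclic_mult_subgroup F a = generate (mult_of F) {a}"

text \<open>The image of an integer under the canonical ring homomorphism from the integers to \<open>F\<close>.\<close>

definition int_embed :: "('a, 'b) ring_scheme \<Rightarrow> int \<Rightarrow> 'a" where
  "int_embed F k = [k] \<cdot>\<^bsub>F\<^esub> \<one>\<^bsub>F\<^esub>"

end

theory Submission
  imports Defs
begin

text \<open>
  Put \<open>G = F\<^sup>*\<close>, a group of order \<open>2 t\<close> with \<open>t\<close> odd. The squares and the elements of odd order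
  are both the \<open>t\<close>-torsion \<open>{a. a\<^sup>t = 1}\<close>: a square has \<open>t\<close>-th power \<open>b\<^sup>2\<^sup>t = 1\<close>, and
  conversely \<open>a\<^sup>t = 1\<close> makes \<open>a = a\<^sup>t\<^sup>+\<^sup>1\<close> a square because \<open>t + 1\<close> is even; this is
  \<open>squares_eq_torsion\<close> and \<open>odd_order_eq_torsion\<close>, valid in any group of order \<open>2 t\<close>.

  Since \<open>F\<close> is a field, the \<open>t\<close>-torsion consists of roots of \<open>X\<^sup>t - 1\<close> and has at most \<open>t\<close> elements.
  So, as \<open>t\<close> is prime, any torsion element other than \<open>1\<close> generates all of it
  (\<open>generate_eq_prime_torsion\<close>). The element \<open>4 = 2\<^sup>2\<close> is such an element: it is a nonzero
  square, and \<open>4 = 1\<close> would force the characteristic \<open>q\<close> to be \<open>3\<close>, whereas \<open>q = 2 t + 1 \<ge> 7\<close>.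
\<close>

context group
begin

lemma squares_eq_torsion:
  assumes "order G = 2 * t" and "odd t"
  shows "{a [^] (2::nat) | a. a \<in> carrier G} = {a \<in> carrier G. a [^] t = \<one>}"
proof (intro equalityI subsetI)
  fix x assume "x \<in> {a [^] (2::nat) | a. a \<in> carrier G}"
  then obtain a where a: "a \<in> carrier G" "x = a [^] (2::nat)" by blast
  then have "x [^] t = a [^] order G" by (simp add: nat_pow_pow assms(1))
  with a show "x \<in> {a \<in> carrier G. a [^] t = \<one>}" by (simp add: pow_order_eq_1)
next
  fix x assume "x \<in> {a \<in> carrier G. a [^] t = \<one>}"
  then have x: "x \<in> carrier G" "x [^] t = \<one>" by auto
  from \<open>odd t\<close> obtain k where k: "t + 1 = k * 2" by (metis dvd_def even_plus_one_iff mult.commute)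
  have "x = x [^] (t + 1)" using x by simp
  also have "\<dots> = (x [^] k) [^] (2::nat)" unfolding k by (simp only: nat_pow_pow[OF x(1)])
  finally show "x \<in> {a [^] (2::nat) | a. a \<in> carrier G}" using x by blast
qed

lemma odd_order_eq_torsion:
  assumes "order G = 2 * t" and "odd t"
  shows "{a \<in> carrier G. odd (ord a)} = {a \<in> carrier G. a [^] t = \<one>}"
proof -
  have "odd (ord a) \<longleftrightarrow> ord a dvd t" if "a \<in> carrier G" for a
  proof
    assume "odd (ord a)"
    then have "coprime (ord a) 2" by simp
    moreover have "ord a dvd 2 * t" using ord_dvd_group_order[OF that] assms(1) by simp
    ultimately show "ord a dvd t" by (simp add: coprime_dvd_mult_right_iff)
  next
    assume "ord a dvd t"
    then show "odd (ord a)" using \<open>odd t\<close> dvd_trans by blast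
  qed
  then show ?thesis using pow_eq_id by blast
qed

text \<open>
  The order of \<open>g\<close> divides the prime \<open>p\<close> and is not \<open>1\<close>, so \<open>\<langle>g\<rangle>\<close> already has as many elements as
  the bound allows for the \<open>p\<close>-torsion containing it.
\<close>

lemma generate_eq_prime_torsion:
  assumes p: "Factorial_Ring.prime p"
    and fin: "finite {x \<in> carrier G. x [^] p = \<one>}"
    and bound: "card {x \<in> carrier G. x [^] p = \<one>} \<le> p"
    and g: "g \<in> carrier G" "g [^] p = \<one>" "g \<noteq> \<one>"
  shows "generate G {g} = {x \<in> carrier G. x [^] p = \<one>}"
proof (rule card_seteq[OF fin])
  have ord: "ord g = p"
    using p g ord_eq_1 by (metis pow_eq_id prime_nat_iff)
  show "generate G {g} \<subseteq> {x \<in> carrier G. x [^] p = \<one>}"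
  proof
    fix x assume "x \<in> generate G {g}"
    then obtain k :: nat where "x = g [^] k"
      using generate_pow_nat[OF g(1)] ord prime_gt_0_nat[OF p] by auto
    moreover have "(g [^] k) [^] p = (g [^] p) [^] k"
      by (simp only: nat_pow_pow[OF g(1)] mult.commute)
    ultimately show "x \<in> {x \<in> carrier G. x [^] p = \<one>}" using g by simp
  qed
  show "card {x \<in> carrier G. x [^] p = \<one>} \<le> card (generate G {g})"
    using bound ord generate_pow_card[OF g(1)] by simp
qed

end

lemma (in ring) int_embed_closed: "int_embed R k \<in> carrier R"
  unfolding int_embed_def by simp

lemma (in ring) int_embed_mult: "int_embed R (k * l) = int_embed R k \<otimes> int_embed R l"
  unfolding int_embed_def
  by (simp add: add_pow_ldistr_int add.int_pow_pow mult.commute)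

text \<open>
  By Lagrange the additive order of \<open>\<one>\<close> divides the prime number of elements of \<open>R\<close>, and it is
  not \<open>1\<close> because \<open>\<one> \<noteq> \<zero>\<close>; hence it is the number of elements.
\<close>

lemma (in domain) int_embed_eq_iff_prime_card:
  assumes "Factorial_Ring.prime (card (carrier R))"
  shows "int_embed R k = int_embed R l \<longleftrightarrow> int (card (carrier R)) dvd k - l"
proof -
  have "group.ord (add_monoid R) \<one> dvd card (carrier R)"
    using add.ord_dvd_group_order[of \<one>] by (simp add: order_def)
  moreover have "group.ord (add_monoid R) \<one> \<noteq> 1"
    using add.ord_eq_1[of \<one>] by simp
  ultimately have ord: "group.ord (add_monoid R) \<one> = card (carrier R)"
    using assms by (metis prime_nat_iff)
  have "int_embed R k = int_embed R l \<longleftrightarrow> [(k - l)] \<cdot> \<one> = \<zero>"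
    unfolding int_embed_def by (simp add: add.int_pow_diff r_right_minus_eq[unfolded minus_eq])
  also have "\<dots> \<longleftrightarrow> int (card (carrier R)) dvd k - l"
    using add.int_pow_eq_id[of \<one>] ord by simp
  finally show ?thesis .
qed

theorem theorem4p2:
  fixes F :: "('a, 'b) ring_scheme" and q t :: nat
  assumes "field F" and "card (carrier F) = q"
    and "Factorial_Ring.prime q" and "odd q" and "Factorial_Ring.prime t" and "odd t"
    and "q = 2 * t + 1"
  shows "nonzero_squares F = odd_order_elements F
    \<and> odd_order_elements F = cyclic_mult_subgroup F (int_embed F 4)"
proof -
  interpret field F by fact
  interpret G: group "mult_of F" by (rule field_mult_group)
  define T where "T = {a \<in> carrier (mult_of F). a [^]\<^bsub>mult_of F\<^esub> t = \<one>\<^bsub>mult_of F\<^esub>}"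
  let ?g = "int_embed F 4"

  have t: "t \<ge> 3"
    using \<open>Factorial_Ring.prime t\<close> \<open>odd t\<close> prime_ge_2_nat[of t] by (cases "t = 2") auto
  have fin: "finite (carrier F)"
    using assms(2) t \<open>q = 2 * t + 1\<close> by (intro card_ge_0_finite) simp
  have order: "order (mult_of F) = 2 * t"
    using order_mult_of[OF fin] assms(2,7) by (simp add: order_def)
  have squares: "nonzero_squares F = T"
    using G.squares_eq_torsion[OF order \<open>odd t\<close>]
    unfolding nonzero_squares_def T_def by (simp add: nat_pow_mult_of)
  have odd_order: "odd_order_elements F = T"
    using G.odd_order_eq_torsion[OF order \<open>odd t\<close>]
    unfolding odd_order_elements_def T_def by simp

  have embed_iff: "int_embed F k = int_embed F l \<longleftrightarrow> int q dvd k - l" for k l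
    using int_embed_eq_iff_prime_card assms(2,3) by simp
  have embed01: "int_embed F 0 = \<zero>\<^bsub>F\<^esub>" "int_embed F 1 = \<one>\<^bsub>F\<^esub>"
    by (simp_all add: int_embed_def add_pow_int_ge add.int_pow_1)
  have small: "\<not> int q dvd k" if "0 < k" "k < 7" for k
    using zdvd_imp_le[of "int q" k] that t \<open>q = 2 * t + 1\<close> by auto
  have "int_embed F 2 \<noteq> \<zero>\<^bsub>F\<^esub>" "?g \<noteq> \<one>\<^bsub>F\<^esub>"
    using embed_iff[of 2 0] embed_iff[of 4 1] small by (auto simp: embed01)
  moreover have "?g = int_embed F 2 [^]\<^bsub>F\<^esub> (2::nat)"
    using int_embed_mult[of 2 2] int_embed_closed[of 2] by (simp add: numeral_2_eq_2)
  ultimately have "?g \<in> T"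
    unfolding squares[symmetric] nonzero_squares_def using int_embed_closed by auto

  have "T \<subseteq> {x \<in> carrier F. x [^]\<^bsub>F\<^esub> t = \<one>\<^bsub>F\<^esub>}"
    unfolding T_def by (auto simp: nat_pow_mult_of)
  then have "card T \<le> t"
    using num_roots_le_deg[OF fin, of t] t fin card_mono[of "{x \<in> carrier F. x [^]\<^bsub>F\<^esub> t = \<one>\<^bsub>F\<^esub>}" T]
    by simp
  then have "generate (mult_of F) {?g} = T"
    using G.generate_eq_prime_torsion[OF \<open>Factorial_Ring.prime t\<close>, of ?g]
      \<open>?g \<in> T\<close> \<open>?g \<noteq> \<one>\<^bsub>F\<^esub>\<close> fin
    unfolding T_def by simp
  with squares odd_order show ?thesis
    unfolding cyclic_mult_subgroup_def by simp
qed

end
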